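(* Suppose Assumptions 1--4 listed in the context hold, with constants $G, M, R, \epsilon$. Define the maximum variation of consecutive constraints $$\bar V(\mathbf g):=\max_{t\ge 1} V(\mathbf g_t),\qquad V(\mathbf g_t):=\max_{\mathbf x\in\mathcal X}\big\|[\mathbf g_{t+1}(\mathbf x)-\mathbf g_t(\mathbf x)]^+\big\|,$$ and assume $\epsilon>\bar V(\mathbf g)$. Let $\{\mathbf x_t\},\{\boldsymbol\lambda_t\}$ be generated by the MOSP recursion (see context) with stepsizes $\alpha,\mu>0$ and $\boldsymbol\lambda_1=\mathbf 0$. Then for every $t\ge 1$, $$\|\boldsymbol\lambda_t\|\le \Lambda:=\mu M+\frac{2GR+R^2/(2\alpha)+\mu M^2/2}{\epsilon-\bar V(\mathbf g)},$$ and for every horizon $T\ge 1$ the dynamic fit $\mathrm{Fit}^{\rm d}_T:=\big\|\big[\sum_{t=1}^T\mathbf g_t(\mathbf x_t)\big]^+\big\|$ satisfies $$\mathrm{Fit}^{\rm d}_T\le\frac{\|\boldsymbol\lambda_{T+1}\|}{\mu}\le\frac{\Lambda}{\mu}=M+\frac{2GR/\mu+R^2/(2\alpha\mu)+M^2/2}{\epsilon-\bar V(\mathbf g)}.$$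
   Context: Notation: $\|\cdot\|$ is the Euclidean norm, $[\mathbf a]^+:=\max\{\mathbf a,\mathbf 0\}$ entrywise, vector inequalities are entrywise, $\mathbf 1$ is the all-ones vector. Setting: $\mathcal X\subseteq\mathbb R^I$ is a fixed convex set. For each time slot $t$ there are a loss $f_t:\mathbb R^I\to\mathbb R$ and a constraint function $\mathbf g_t:\mathbb R^I\to\mathbb R^I$; slots are indexed by $t=0,1,2,\dots$, where $f_0,\mathbf g_0$ only serve to define the first iterate. All minima and maxima over $\mathcal X$ that are written down are assumed to be attained; a maximum over infinitely many $t$ is read as a supremum. Assumptions: 1. For every $t$, $f_t$ is convex (with gradient $\nabla f_t$) and $\mathbf g_t$ is (entrywise) convex. 2. For every $t$, $\|\nabla f_t(\mathbf x)\|\le G$ and $\|\mathbf g_t(\mathbf x)\|\le M$ for all $\mathbf x\in\mathcal X$. 3. $\|\mathbf x-\mathbf y\|\le R$ for all $\mathbf x,\mathbf y\in\mathcal X$. 4. There are a constant $\epsilon>0$ and an interior point $\tilde{\mathbf x}\in\mathcal X$ with $\mathbf g_t(\tilde{\mathbf x})\le-\epsilon\mathbf 1$ for all $t$. MOSP recursion (modified online saddle-point method) with stepsizes $\alpha,\mu>0$: start from $\mathbf x_0\in\mathcal X$ and a dual vector $\boldsymbol\lambda_1\in\mathbb R^I_+$; for $t=1,2,\dots$ let $\mathbf x_t$ be the minimizer over $\mathbf x\in\mathcal X$ of $$\nabla f_{t-1}(\mathbf x_{t-1})^\top(\mathbf x-\mathbf x_{t-1})+\boldsymbol\lambda_t^\top\mathbf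 g_{t-1}(\mathbf x)+\frac{1}{2\alpha}\|\mathbf x-\mathbf x_{t-1}\|^2,$$ and set $\boldsymbol\lambda_{t+1}=[\boldsymbol\lambda_t+\mu\,\mathbf g_t(\mathbf x_t)]^+$. *)

theory Defs
  imports "HOL-Analysis.Analysis"
begin

definition pos_part :: "real ^ 'i \<Rightarrow> real ^ 'i" where
  "pos_part a = (\<chi> k. max (a $ k) 0)"

text \<open>
  The two suprema below are taken in \<^typ>\<open>real\<close>, so they are meaningful only for sets that are
  bounded above (and nonempty). This is the case as soon as \<open>X\<close> is nonempty and all \<open>g t\<close> are
  bounded on \<open>X\<close> by a common constant.
\<close>

definition variation :: "(real ^ 'i) set \<Rightarrow> (nat \<Rightarrow> real ^ 'i \<Rightarrow> real ^ 'i) \<Rightarrow> nat \<Rightarrow> real" where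
  "variation X g t = (SUP x\<in>X. norm (pos_part (g (t + 1) x - g t x)))"

definition max_variation :: "(real ^ 'i) set \<Rightarrow> (nat \<Rightarrow> real ^ 'i \<Rightarrow> real ^ 'i) \<Rightarrow> real" where
  "max_variation X g = (SUP t\<in>{1..}. variation X g t)"

definition mosp_objective ::
  "real ^ 'i \<Rightarrow> (real ^ 'i \<Rightarrow> real ^ 'i) \<Rightarrow> real \<Rightarrow> real ^ 'i \<Rightarrow> real ^ 'i \<Rightarrow> real ^ 'i \<Rightarrow> real" where
  "mosp_objective d h \<alpha> y lam z =
     d \<bullet> (z - y) + lam \<bullet> h z + 1 / (2 * \<alpha>) * (norm (z - y))\<^sup>2"

text \<open>
  In \<open>mosp\<close>, \<open>df t\<close> is the gradient of the loss of slot \<open>t\<close>. Dual vectors are indexed from 1;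
  the value \<open>lam 0\<close> is irrelevant.
\<close>

definition mosp ::
  "(real ^ 'i) set \<Rightarrow> (nat \<Rightarrow> real ^ 'i \<Rightarrow> real ^ 'i) \<Rightarrow> (nat \<Rightarrow> real ^ 'i \<Rightarrow> real ^ 'i) \<Rightarrow>
   real \<Rightarrow> real \<Rightarrow> (nat \<Rightarrow> real ^ 'i) \<Rightarrow> (nat \<Rightarrow> real ^ 'i) \<Rightarrow> bool" where
  "mosp X df g \<alpha> \<mu> x lam \<longleftrightarrow>
     x 0 \<in> X \<and> 0 \<le> lam 1 \<and>
     (\<forall>t\<ge>1.
        is_arg_min (mosp_objective (df (t - 1) (x (t - 1))) (g (t - 1)) \<alpha> (x (t - 1)) (lam t))
          (\<lambda>z. z \<in> X) (x t) \<and>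
        lam (t + 1) = pos_part (lam t + \<mu> *\<^sub>R g t (x t)))"

definition dynamic_fit ::
  "(nat \<Rightarrow> real ^ 'i \<Rightarrow> real ^ 'i) \<Rightarrow> (nat \<Rightarrow> real ^ 'i) \<Rightarrow> nat \<Rightarrow> real" where
  "dynamic_fit g x T = norm (pos_part (\<Sum>t=1..T. g t (x t)))"

end

theory Submission
  imports Defs
begin

text \<open>
  Comparing the primal minimizer with the Slater point gives
  \<open>\<lambda>\<^sub>t \<bullet> g\<^sub>t\<^sub>-\<^sub>1 (x\<^sub>t) \<le> 2 G R + R\<^sup>2 / (2 \<alpha>) - \<epsilon> \<parallel>\<lambda>\<^sub>t\<parallel>\<close>, and replacing \<open>g\<^sub>t\<^sub>-\<^sub>1\<close> by \<open>g\<^sub>t\<close> costs at most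
  \<open>V \<parallel>\<lambda>\<^sub>t\<parallel>\<close>; for \<open>t = 1\<close>, where \<open>V\<close> says nothing about \<open>g\<^sub>0\<close>, it costs nothing because \<open>\<lambda>\<^sub>1 = 0\<close>.
  Inserted into \<open>\<parallel>\<lambda>\<^sub>t\<^sub>+\<^sub>1\<parallel>\<^sup>2 \<le> \<parallel>\<lambda>\<^sub>t + \<mu> g\<^sub>t (x\<^sub>t)\<parallel>\<^sup>2\<close>, this shows that \<open>\<parallel>\<lambda>\<parallel>\<close> does not increase as soon as it
  exceeds \<open>B = \<Lambda> - \<mu> M\<close>; one step increases it by at most \<open>\<mu> M\<close>, so it never exceeds \<open>B + \<mu> M\<close>.
  The fit bound holds because \<open>\<lambda>\<^sub>T\<^sub>+\<^sub>1\<close> dominates \<open>\<mu> \<Sum> g\<^sub>t (x\<^sub>t)\<close> entrywise.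
\<close>

lemma pos_part_nonneg: "0 \<le> pos_part a"
  by (simp add: pos_part_def less_eq_vec_def)

lemma pos_part_ge: "a \<le> pos_part a"
  by (simp add: pos_part_def less_eq_vec_def)

lemma pos_part_least: "a \<le> b \<Longrightarrow> 0 \<le> b \<Longrightarrow> pos_part a \<le> b"
  by (simp add: pos_part_def less_eq_vec_def)

lemma norm_pos_part_le: "norm (pos_part a) \<le> norm a"
  by (rule norm_le_componentwise_cart) (auto simp: pos_part_def)

lemma norm_mono_nonneg:
  fixes a b :: "real ^ 'n"
  assumes "0 \<le> a" "a \<le> b"
  shows "norm a \<le> norm b"
proof (rule norm_le_componentwise_cart)
  fix i
  have "0 \<le> a $ i" "a $ i \<le> b $ i"
    using assms by (simp_all add: less_eq_vec_def)
  then show "norm (a $ i) \<le> norm (b $ i)" by simp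
qed

lemma inner_mono_nonneg:
  fixes u a b :: "real ^ 'n"
  assumes "0 \<le> u" "a \<le> b"
  shows "u \<bullet> a \<le> u \<bullet> b"
  using assms by (auto simp: inner_vec_def less_eq_vec_def intro!: sum_mono mult_left_mono)

text \<open>For nonnegative \<open>u\<close> the inner product with \<open>1\<close> is the l1 norm,
  which dominates the Euclidean norm. This turns the entrywise Slater margin into a multiple of
  \<open>norm lam\<close>.\<close>

lemma norm_le_inner_one:
  fixes u :: "real ^ 'n"
  assumes "0 \<le> u"
  shows "norm u \<le> u \<bullet> 1"
  using norm_le_l1_cart[of u] assms by (simp add: inner_vec_def less_eq_vec_def)

text \<open>Against a nonnegative vector, negative entries only lower the inner product;
  Cauchy-Schwarz does the rest. Hence only increases of the constraints count in
  \<open>variation\<close>.\<close>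

lemma inner_le_norm_pos_part:
  fixes u a :: "real ^ 'n"
  assumes "0 \<le> u"
  shows "u \<bullet> a \<le> norm u * norm (pos_part a)"
  using inner_mono_nonneg[OF assms pos_part_ge] norm_cauchy_schwarz order_trans by blast

text \<open>The crude bound \<open>2 * M\<close> from the triangle inequality makes the real suprema
  meaningful, both over \<open>X\<close> and later over the slots.\<close>

lemma variation_bounds:
  fixes g :: "nat \<Rightarrow> real ^ 'n \<Rightarrow> real ^ 'n"
  assumes bound: "\<And>t z. z \<in> X \<Longrightarrow> norm (g t z) \<le> M" and "z \<in> X"
  shows norm_pos_part_diff_le_variation: "norm (pos_part (g (t + 1) z - g t z)) \<le> variation X g t"
    and variation_le: "variation X g t \<le> 2 * M"
proof -
  have le: "norm (pos_part (g (t + 1) y - g t y)) \<le> 2 * M" if "y \<in> X" for y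
    using norm_pos_part_le[of "g (t + 1) y - g t y"] norm_triangle_ineq4[of "g (t + 1) y" "g t y"]
      bound[OF that, of "t + 1"] bound[OF that, of t] by linarith
  show "norm (pos_part (g (t + 1) z - g t z)) \<le> variation X g t"
    unfolding variation_def using \<open>z \<in> X\<close> le by (intro cSUP_upper bdd_aboveI2) auto
  show "variation X g t \<le> 2 * M"
    unfolding variation_def using \<open>z \<in> X\<close> le by (intro cSUP_least) auto
qed

lemma norm_pos_part_diff_le_max_variation:
  fixes g :: "nat \<Rightarrow> real ^ 'n \<Rightarrow> real ^ 'n"
  assumes bound: "\<And>t z. z \<in> X \<Longrightarrow> norm (g t z) \<le> M" and "z \<in> X" "t \<ge> 1"
  shows "norm (pos_part (g (t + 1) z - g t z)) \<le> max_variation X g"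
proof -
  have "variation X g t \<le> max_variation X g"
    unfolding max_variation_def using variation_le[of X g M, OF bound \<open>z \<in> X\<close>] \<open>t \<ge> 1\<close>
    by (intro cSUP_upper bdd_aboveI2) auto
  then show ?thesis
    using norm_pos_part_diff_le_variation[of X g M, OF bound \<open>z \<in> X\<close>] order_trans by blast
qed

lemma mosp_objective_min_le:
  fixes d y w z lam :: "real ^ 'n"
  assumes min: "is_arg_min (mosp_objective d h \<alpha> y lam) (\<lambda>z. z \<in> X) z"
    and "y \<in> X" "w \<in> X"
    and d: "norm d \<le> G"
    and diameter: "\<And>u v. u \<in> X \<Longrightarrow> v \<in> X \<Longrightarrow> norm (u - v) \<le> R"
    and lam: "0 \<le> lam" and slater: "h w \<le> - (\<epsilon> *\<^sub>R 1)"
    and "\<epsilon> \<ge> 0" "\<alpha> > 0"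
  shows "lam \<bullet> h z \<le> 2 * G * R + R\<^sup>2 / (2 * \<alpha>) - \<epsilon> * norm lam"
proof -
  have "z \<in> X" using min by (simp add: is_arg_min_def)
  have "mosp_objective d h \<alpha> y lam z \<le> mosp_objective d h \<alpha> y lam w"
    using min \<open>w \<in> X\<close> by (auto simp: is_arg_min_def not_less)
  \<comment> \<open>Applied to \<open>z\<close> and to \<open>w\<close>, this is the source of the
    term \<open>2 * G * R\<close>.\<close>
  moreover have G: "\<bar>d \<bullet> (v - y)\<bar> \<le> G * R" if "v \<in> X" for v
    using Cauchy_Schwarz_ineq2[of d "v - y"]
      mult_mono[OF d diameter[OF that \<open>y \<in> X\<close>] order_trans[OF norm_ge_zero d] norm_ge_zero]
    by linarith
  moreover have "1 / (2 * \<alpha>) * (norm (w - y))\<^sup>2 \<le> R\<^sup>2 / (2 * \<alpha>)"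
    using diameter[OF \<open>w \<in> X\<close> \<open>y \<in> X\<close>] \<open>\<alpha> > 0\<close> by (simp add: divide_right_mono power_mono)
  moreover have "0 \<le> 1 / (2 * \<alpha>) * (norm (z - y))\<^sup>2"
    using \<open>\<alpha> > 0\<close> by simp
  moreover have "lam \<bullet> h w \<le> - (\<epsilon> * norm lam)"
    using inner_mono_nonneg[OF lam slater] mult_left_mono[OF norm_le_inner_one[OF lam] \<open>\<epsilon> \<ge> 0\<close>]
    by simp
  ultimately show ?thesis
    using G[OF \<open>z \<in> X\<close>] G[OF \<open>w \<in> X\<close>] unfolding mosp_objective_def by linarith
qed

text \<open>Induction step for the dual bound: the ball of this radius is invariant. The cases are
  separated by the radius beyond which the linear decrease outweighs the quadratic term.\<close>

lemma norm_dual_step_le: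
  fixes l c :: "real ^ 'n"
  assumes inner: "l \<bullet> c \<le> D - \<delta> * norm l"
    and c: "norm c \<le> M" and "\<delta> > 0" "\<mu> > 0"
    and bound: "norm l \<le> \<mu> * M + (D + \<mu> * M\<^sup>2 / 2) / \<delta>"
  shows "norm (pos_part (l + \<mu> *\<^sub>R c)) \<le> \<mu> * M + (D + \<mu> * M\<^sup>2 / 2) / \<delta>"
proof (cases "norm l \<le> (D + \<mu> * M\<^sup>2 / 2) / \<delta>")
  case True
  have "norm (pos_part (l + \<mu> *\<^sub>R c)) \<le> norm l + \<mu> * norm c"
    using norm_pos_part_le[of "l + \<mu> *\<^sub>R c"] norm_triangle_ineq[of l "\<mu> *\<^sub>R c"] \<open>\<mu> > 0\<close> by simp
  also have "\<dots> \<le> norm l + \<mu> * M"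
    using c \<open>\<mu> > 0\<close> by simp
  finally show ?thesis using True by linarith
next
  case False
  then have "D + \<mu> * M\<^sup>2 / 2 \<le> \<delta> * norm l"
    using \<open>\<delta> > 0\<close> by (simp add: field_simps)
  moreover have "\<mu> * (norm c)\<^sup>2 / 2 \<le> \<mu> * M\<^sup>2 / 2"
    using c \<open>\<mu> > 0\<close> by (simp add: power_mono)
  ultimately have "l \<bullet> c + \<mu> * (norm c)\<^sup>2 / 2 \<le> 0"
    using inner by linarith
  \<comment> \<open>The factor \<open>2 * \<mu>\<close> produces exactly the increment of the
    squared norm in the expansion below.\<close>
  then have "2 * \<mu> * (l \<bullet> c + \<mu> * (norm c)\<^sup>2 / 2) \<le> 0"
    using \<open>\<mu> > 0\<close> by (intro mult_nonneg_nonpos) auto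
  moreover have "(norm (l + \<mu> *\<^sub>R c))\<^sup>2 = (norm l)\<^sup>2 + 2 * \<mu> * (l \<bullet> c + \<mu> * (norm c)\<^sup>2 / 2)"
    by (simp only: power2_norm_eq_inner)
      (simp add: inner_add_left inner_add_right inner_commute algebra_simps power2_eq_square)
  ultimately have "norm (l + \<mu> *\<^sub>R c) \<le> norm l"
    using power2_le_imp_le[of "norm (l + \<mu> *\<^sub>R c)" "norm l"] by simp
  then show ?thesis
    using norm_pos_part_le[of "l + \<mu> *\<^sub>R c"] bound by linarith
qed

lemma mosp_iterate_mem: "mosp X df g \<alpha> \<mu> x lam \<Longrightarrow> x t \<in> X"
  by (cases "t = 0") (auto simp: mosp_def is_arg_min_def)

lemma mosp_dual_nonneg:
  assumes "mosp X df g \<alpha> \<mu> x lam" "t \<ge> 1"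
  shows "0 \<le> lam t"
  using \<open>t \<ge> 1\<close>
proof (induction t rule: dec_induct)
  case base
  show ?case using assms by (simp add: mosp_def)
next
  case (step t)
  then show ?case using assms pos_part_nonneg by (simp add: mosp_def)
qed

text \<open>Each projection only raises entries, so omitting all of them gives a lower bound, which
  telescopes.\<close>

lemma mosp_sum_le_dual:
  assumes mosp: "mosp X df g \<alpha> \<mu> x lam"
  shows "lam 1 + \<mu> *\<^sub>R (\<Sum>t=1..T. g t (x t)) \<le> lam (T + 1)"
proof (induction T)
  case 0
  show ?case by simp
next
  case (Suc T)
  have "lam 1 + \<mu> *\<^sub>R (\<Sum>t=1..Suc T. g t (x t))
      = (lam 1 + \<mu> *\<^sub>R (\<Sum>t=1..T. g t (x t))) + \<mu> *\<^sub>R g (Suc T) (x (Suc T))"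
    by (simp add: scaleR_add_right)
  also have "\<dots> \<le> lam (Suc T) + \<mu> *\<^sub>R g (Suc T) (x (Suc T))"
    using Suc by (intro add_right_mono) simp
  also have "\<dots> \<le> lam (Suc T + 1)"
    using mosp pos_part_ge by (simp add: mosp_def)
  finally show ?case .
qed

text \<open>The scaled dual vector is a nonnegative upper bound of the sum, hence also of its
  positive part, and the norm is monotone on nonnegative vectors.\<close>

lemma dynamic_fit_le_dual:
  assumes mosp: "mosp X df g \<alpha> \<mu> x lam" and "\<mu> > 0"
  shows "dynamic_fit g x T \<le> norm (lam (T + 1)) / \<mu>"
proof -
  have nonneg: "0 \<le> lam (T + 1)" "0 \<le> lam 1"
    using mosp_dual_nonneg[OF mosp] by auto
  have "(\<Sum>t=1..T. g t (x t)) \<le> lam (T + 1) /\<^sub>R \<mu>"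
    unfolding less_eq_vec_def
  proof
    fix i
    have "lam 1 $ i + \<mu> * (\<Sum>t=1..T. g t (x t)) $ i \<le> lam (T + 1) $ i" "0 \<le> lam 1 $ i"
      using mosp_sum_le_dual[OF mosp, of T] nonneg(2)
      by (simp_all only: less_eq_vec_def vector_add_component vector_scaleR_component
          zero_index real_scaleR_def)
    then show "(\<Sum>t=1..T. g t (x t)) $ i \<le> (lam (T + 1) /\<^sub>R \<mu>) $ i"
      using \<open>\<mu> > 0\<close> by (simp add: field_simps)
  qed
  moreover have "0 \<le> lam (T + 1) /\<^sub>R \<mu>"
    using nonneg(1) \<open>\<mu> > 0\<close> by (simp add: less_eq_vec_def)
  ultimately have "norm (pos_part (\<Sum>t=1..T. g t (x t))) \<le> norm (lam (T + 1) /\<^sub>R \<mu>)"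
    by (intro norm_mono_nonneg pos_part_nonneg pos_part_least)
  then show ?thesis
    using \<open>\<mu> > 0\<close> by (simp add: dynamic_fit_def divide_inverse mult.commute)
qed

theorem theorem1:
  fixes X :: "(real ^ 'i) set"
    and f :: "nat \<Rightarrow> real ^ 'i \<Rightarrow> real"
    and df :: "nat \<Rightarrow> real ^ 'i \<Rightarrow> real ^ 'i"
    and g :: "nat \<Rightarrow> real ^ 'i \<Rightarrow> real ^ 'i"
    and x lam :: "nat \<Rightarrow> real ^ 'i"
    and xt :: "real ^ 'i"
    and G M R \<epsilon> \<alpha> \<mu> :: real
  assumes X_convex: "convex X"
    and f_convex: "\<And>t. convex_on UNIV (f t)"
    and f_gradient: "\<And>t z. GDERIV (f t) z :> df t z"
    and g_convex: "\<And>t i. convex_on UNIV (\<lambda>z. g t z $ i)"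
    and gradient_bound: "\<And>t z. z \<in> X \<Longrightarrow> norm (df t z) \<le> G"
    and g_bound: "\<And>t z. z \<in> X \<Longrightarrow> norm (g t z) \<le> M"
    and diameter: "\<And>y z. y \<in> X \<Longrightarrow> z \<in> X \<Longrightarrow> norm (y - z) \<le> R"
    and eps_pos: "\<epsilon> > 0"
    and slater_interior: "xt \<in> interior X"
    and slater: "\<And>t. g t xt \<le> - (\<epsilon> *\<^sub>R 1)"
    and variation_attained:
      "\<And>t. t \<ge> 1 \<Longrightarrow>
         \<exists>z. is_arg_max (\<lambda>z. norm (pos_part (g (t + 1) z - g t z))) (\<lambda>z. z \<in> X) z"
    and eps_gt: "\<epsilon> > max_variation X g"
    and alpha_pos: "\<alpha> > 0"
    and mu_pos: "\<mu> > 0"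
    and iterates: "mosp X df g \<alpha> \<mu> x lam"
    and lam_init: "lam 1 = 0"
  shows "let \<Lambda> = \<mu> * M +
                 (2 * G * R + R\<^sup>2 / (2 * \<alpha>) + \<mu> * M\<^sup>2 / 2) / (\<epsilon> - max_variation X g)
         in (\<forall>t\<ge>1. norm (lam t) \<le> \<Lambda>) \<and>
            (\<forall>T\<ge>1.
               dynamic_fit g x T \<le> norm (lam (T + 1)) / \<mu> \<and>
               norm (lam (T + 1)) / \<mu> \<le> \<Lambda> / \<mu>) \<and>
            \<Lambda> / \<mu> =
              M + (2 * G * R / \<mu> + R\<^sup>2 / (2 * \<alpha> * \<mu>) + M\<^sup>2 / 2) / (\<epsilon> - max_variation X g)"
proof -
  define \<delta> where "\<delta> = \<epsilon> - max_variation X g"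
  define D where "D = 2 * G * R + R\<^sup>2 / (2 * \<alpha>)"
  define \<Lambda> where "\<Lambda> = \<mu> * M + (D + \<mu> * M\<^sup>2 / 2) / \<delta>"
  have "\<delta> > 0" using eps_gt by (simp add: \<delta>_def)
  have "xt \<in> X" using slater_interior interior_subset by blast
  have nonneg: "0 \<le> G" "0 \<le> M" "0 \<le> R"
    using gradient_bound[OF \<open>xt \<in> X\<close>] g_bound[OF \<open>xt \<in> X\<close>] diameter[OF \<open>xt \<in> X\<close> \<open>xt \<in> X\<close>]
      norm_ge_zero order_trans by blast+
  then have "0 \<le> D" using alpha_pos by (simp add: D_def)
  then have "0 \<le> \<Lambda>" using nonneg mu_pos \<open>\<delta> > 0\<close> by (simp add: \<Lambda>_def)
  note mem = mosp_iterate_mem[OF iterates]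
  have inner: "lam t \<bullet> g t (x t) \<le> D - \<delta> * norm (lam t)" if "t \<ge> 1" for t
  proof (cases "t = 1")
    case True
    then show ?thesis using lam_init \<open>0 \<le> D\<close> by simp
  next
    case False
    \<comment> \<open>\<open>s\<close> is the slot whose loss and constraint determine
      \<open>x t\<close>. Since \<open>t\<close> is not 1, \<open>s \<ge> 1\<close>, so the change
      from \<open>g s\<close> to \<open>g t\<close> is covered by
      \<open>max_variation\<close>.\<close>
    define s where "s = t - 1"
    have s: "s \<ge> 1" "t = s + 1" using that False by (auto simp: s_def)
    have lam: "0 \<le> lam t" using mosp_dual_nonneg[OF iterates that] .
    have "is_arg_min (mosp_objective (df s (x s)) (g s) \<alpha> (x s) (lam t)) (\<lambda>z. z \<in> X) (x t)"
      using iterates that by (simp add: mosp_def s_def)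
    from mosp_objective_min_le[OF this mem \<open>xt \<in> X\<close> gradient_bound[OF mem] diameter lam, OF _ _ slater]
    have "lam t \<bullet> g s (x t) \<le> D - \<epsilon> * norm (lam t)"
      using eps_pos alpha_pos by (simp add: D_def)
    moreover have "lam t \<bullet> (g t (x t) - g s (x t)) \<le> norm (lam t) * max_variation X g"
      using inner_le_norm_pos_part[OF lam, of "g t (x t) - g s (x t)"]
        mult_left_mono[OF norm_pos_part_diff_le_max_variation[of X g M, OF g_bound mem s(1)]
          norm_ge_zero[of "lam t"]] order_trans s(2) by blast
    ultimately show ?thesis
      by (simp add: \<delta>_def inner_diff_right algebra_simps)
  qed
  have lam_le: "norm (lam t) \<le> \<Lambda>" if "t \<ge> 1" for t
    using that
  proof (induction t rule: dec_induct)
    case base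
    show ?case using lam_init \<open>0 \<le> \<Lambda>\<close> by simp
  next
    case (step t)
    have "lam (Suc t) = pos_part (lam t + \<mu> *\<^sub>R g t (x t))"
      using iterates step by (simp add: mosp_def)
    then show ?case
      using norm_dual_step_le[OF inner g_bound[OF mem] \<open>\<delta> > 0\<close> mu_pos] step
      unfolding \<Lambda>_def by simp
  qed
  have "\<Lambda> / \<mu> = M + (2 * G * R / \<mu> + R\<^sup>2 / (2 * \<alpha> * \<mu>) + M\<^sup>2 / 2) / \<delta>"
    using mu_pos alpha_pos \<open>\<delta> > 0\<close> by (simp add: \<Lambda>_def D_def field_simps)
  moreover have "norm (lam (T + 1)) / \<mu> \<le> \<Lambda> / \<mu>" for T
    using lam_le[of "T + 1"] mu_pos by (simp add: divide_right_mono)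
  ultimately show ?thesis
    unfolding Let_def D_def[symmetric] \<delta>_def[symmetric] \<Lambda>_def[symmetric]
    using lam_le dynamic_fit_le_dual[OF iterates mu_pos] by blast
qed

end
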